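(* Let $\mathbf{P}=(p_{ij})$ be a stochastic $n\times n$ matrix such that $p_{ii}>0$ for all $i$. Then $\mathbf{P}$ has exactly one $J_1$-generator. Moreover, this $J_1$-generator $\mathbf{Q}=(q_{ij})$ has elements given by $$q_{ii}=1-\ln\theta_i,\qquad q_{ij}=\frac{\rho(\theta_i,\theta_j)\,p_{ij}}{\theta_i\,p_{ii}}\quad(i\neq j),$$ where $(\theta_1,\dots,\theta_n)$ is the unique fixed point of the vector function $\mathbf{T}=(T_1,\dots,T_n):\mathbb{R}_+^n\to\mathbb{R}_+^n$ given by $$T_i(x_1,\dots,x_n)=\exp\Bigl(W_0\Bigl(\frac{1}{p_{ii}}\sum_{j=1}^n p_{ij}\,\rho(x_i,x_j)\Bigr)\Bigr)\quad\text{for all } i.$$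
   Context: $\mathbb{R}_+$ denotes the set of strictly positive reals. A stochastic matrix has non-negative entries and all row sums equal to $1$. The function $\rho:\mathbb{R}_+^2\to\mathbb{R}_+$ is defined by $\rho(x,y)=xy\,\frac{\ln x-\ln y}{x-y}$ if $x\neq y$ and $\rho(x,x)=x$. $W_0$ is the principal branch of the Lambert W function (the inverse of $w\mapsto we^w$ on $[-1,\infty)$). An intensity matrix (transition rate matrix) is a real $n\times n$ matrix with non-negative off-diagonal entries and zero row sums. A continuous-time homogeneous Markov chain (CTHMC) $(X_t)_{t\ge 0}$ on $\{1,\dots,n\}$ with transition rate matrix $\mathbf{Q}=(q_{ij})$ is the usual Markov jump process: the holding time in state $k$ is exponential with rate $-q_{kk}$ (infinite if $q_{kk}=0$), and when leaving state $i$ the chain jumps to $j\neq i$ with probability $q_{ij}/(-q_{ii})$. $N_J$ is the random number of state changes (jumps) of the chain between $t=0$ and $t=1$. The matrix $\mathbf{P}^{\{N_J\le 1\}}(\mathbf{Q})$ has entries $p^{\{N_J\le 1\}}_{ij}=\mathbb{P}(X_1=j\mid X_0=i,\,N_J\le 1)$ (computed for the chain started in $i$). A $J_1$-generator of a stochastic matrix $\mathbf{P}$ is an intensity matrix $\mathbf{Q}$ with $\mathbf{P}^{\{N_J\le 1\}}(\mathbf{Q})=\mathbf{P}$. *)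

theory Defs
  imports "HOL-Probability.Probability"
begin

section \<open>Stochastic and intensity matrices\<close>

text \<open>The state space is a finite type \<open>'n\<close>; entry \<open>(i, j)\<close> of a matrix \<open>A\<close> is \<open>A $ i $ j\<close>.\<close>

definition stochastic_matrix :: "real ^ 'n ^ 'n \<Rightarrow> bool" where
  "stochastic_matrix P \<longleftrightarrow>
     (\<forall>i j. 0 \<le> P $ i $ j) \<and> (\<forall>i. (\<Sum>j\<in>UNIV. P $ i $ j) = 1)"

definition intensity_matrix :: "real ^ 'n ^ 'n \<Rightarrow> bool" where
  "intensity_matrix Q \<longleftrightarrow>
     (\<forall>i j. i \<noteq> j \<longrightarrow> 0 \<le> Q $ i $ j) \<and> (\<forall>i. (\<Sum>j\<in>UNIV. Q $ i $ j) = 0)"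


section \<open>Continuous-time homogeneous Markov chains\<close>

text \<open>
  For an intensity matrix \<open>Q $ i $ i \<le> 0\<close>, so the two branches of each of the following
  definitions are the cases of a non-absorbing and of an absorbing state \<open>i\<close>.
\<close>

definition holding_measure :: "real ^ 'n ^ 'n \<Rightarrow> 'n \<Rightarrow> ereal measure" where
  "holding_measure Q i =
     (if Q $ i $ i < 0
      then distr (density lborel (exponential_density (- Q $ i $ i))) borel ereal
      else return borel \<infinity>)"

definition jump_pmf :: "real ^ 'n ^ 'n \<Rightarrow> 'n \<Rightarrow> 'n pmf" where
  "jump_pmf Q i =
     (if Q $ i $ i < 0
      then embed_pmf (\<lambda>j. if j = i then 0 else Q $ i $ j / (- Q $ i $ i))
      else return_pmf i)"

text \<open>
  The function passed to \<open>embed_pmf\<close> is a probability mass function when \<open>Q\<close> is an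
  intensity matrix:
\<close>

lemma pmf_jump_pmf:
  fixes Q :: "real ^ 'n ^ 'n"
  assumes "intensity_matrix Q" "Q $ i $ i < 0"
  shows "pmf (jump_pmf Q i) j = (if j = i then 0 else Q $ i $ j / (- Q $ i $ i))"
proof -
  let ?f = "\<lambda>j. if j = i then 0 else Q $ i $ j / (- Q $ i $ i)"
  have nonneg: "0 \<le> ?f j" for j
    using assms by (auto simp: intensity_matrix_def divide_nonneg_neg zero_le_divide_iff)
  have "(\<Sum>j\<in>UNIV. Q $ i $ j) = Q $ i $ i + (\<Sum>j\<in>UNIV - {i}. Q $ i $ j)"
    by (simp add: sum.remove)
  moreover have "(\<Sum>j\<in>UNIV. Q $ i $ j) = 0"
    using assms(1) by (simp add: intensity_matrix_def)
  ultimately have *: "(\<Sum>j\<in>UNIV - {i}. Q $ i $ j) = - Q $ i $ i"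
    by simp
  have "(\<Sum>j\<in>UNIV. ?f j) = (\<Sum>j\<in>UNIV - {i}. Q $ i $ j / (- Q $ i $ i))"
    by (intro sum.mono_neutral_cong_right) auto
  also have "\<dots> = (\<Sum>j\<in>UNIV - {i}. Q $ i $ j) / (- Q $ i $ i)"
    by (rule sum_divide_distrib [symmetric])
  also have "\<dots> = 1"
    unfolding * using assms(2) by simp
  finally have "(\<Sum>j\<in>UNIV. ?f j) = 1" .
  then have "(\<integral>\<^sup>+ j. ennreal (?f j) \<partial>count_space UNIV) = 1"
    by (subst nn_integral_count_space_finite) (auto simp: sum_ennreal nonneg simp del: minus_divide_right)
  from pmf_embed_pmf [OF nonneg this] show ?thesis
    using assms(2) by (simp add: jump_pmf_def)
qed

text \<open>
  A sample point \<open>\<omega>\<close> holds, for each step \<open>k\<close> and each state \<open>i\<close>, a pair consisting of the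
  holding time and the successor state used if the \<open>k\<close>-th visited state is \<open>i\<close>. All these
  variables are independent, so along the visited states the holding times and jumps have
  the prescribed conditional laws.
\<close>

definition chain_measure :: "real ^ 'n ^ 'n \<Rightarrow> (nat \<times> 'n \<Rightarrow> ereal \<times> 'n) measure" where
  "chain_measure Q =
     PiM UNIV (\<lambda>(k, i). holding_measure Q i \<Otimes>\<^sub>M measure_pmf (jump_pmf Q i))"

lemma prob_space_holding_measure: "prob_space (holding_measure Q i)"
  unfolding holding_measure_def
  by (auto intro!: prob_space.prob_space_distr prob_space_exponential_density prob_space_return)

lemma prob_space_chain_measure: "prob_space (chain_measure Q)"
  unfolding chain_measure_def
  by (intro prob_space_PiM)
     (auto intro!: prob_space_pair prob_space_holding_measure prob_space_measure_pmf)

fun visited_state :: "'n \<Rightarrow> nat \<Rightarrow> (nat \<times> 'n \<Rightarrow> ereal \<times> 'n) \<Rightarrow> 'n" where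
  "visited_state i 0 \<omega> = i"
| "visited_state i (Suc k) \<omega> = snd (\<omega> (k, visited_state i k \<omega>))"

definition holding_time :: "'n \<Rightarrow> nat \<Rightarrow> (nat \<times> 'n \<Rightarrow> ereal \<times> 'n) \<Rightarrow> ereal" where
  "holding_time i k \<omega> = fst (\<omega> (k, visited_state i k \<omega>))"

definition jump_time :: "'n \<Rightarrow> nat \<Rightarrow> (nat \<times> 'n \<Rightarrow> ereal \<times> 'n) \<Rightarrow> ereal" where
  "jump_time i k \<omega> = (\<Sum>l<k. holding_time i l \<omega>)"

text \<open>
  Number of jumps in \<open>[0, t]\<close> of the chain started in \<open>i\<close>. An absorbing state has infinite
  holding time and every jump from a non-absorbing state changes the state, so these are
  exactly the state changes. The value is \<open>\<infinity>\<close> on the null event that the chain explodes.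
\<close>

definition num_jumps :: "'n \<Rightarrow> real \<Rightarrow> (nat \<times> 'n \<Rightarrow> ereal \<times> 'n) \<Rightarrow> enat" where
  "num_jumps i t \<omega> = (SUP k\<in>{k. jump_time i k \<omega> \<le> ereal t}. enat k)"

definition chain_state :: "'n \<Rightarrow> real \<Rightarrow> (nat \<times> 'n \<Rightarrow> ereal \<times> 'n) \<Rightarrow> 'n" where
  "chain_state i t \<omega> = visited_state i (the_enat (num_jumps i t \<omega>)) \<omega>"


section \<open>Generators conditioned on at most one jump\<close>

definition at_most_one_jump_matrix :: "real ^ 'n ^ 'n \<Rightarrow> real ^ 'n ^ 'n" where
  "at_most_one_jump_matrix Q =
     (\<chi> i j. \<P>(\<omega> in chain_measure Q. chain_state i 1 \<omega> = j \<bar> num_jumps i 1 \<omega> \<le> 1))"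

definition J1_generator :: "real ^ 'n ^ 'n \<Rightarrow> real ^ 'n ^ 'n \<Rightarrow> bool" where
  "J1_generator P Q \<longleftrightarrow> intensity_matrix Q \<and> at_most_one_jump_matrix Q = P"


section \<open>The fixed-point map\<close>

definition rho :: "real \<Rightarrow> real \<Rightarrow> real" where
  "rho x y = (if x = y then x else x * y * ((ln x - ln y) / (x - y)))"

definition Lambert_W0 :: "real \<Rightarrow> real" where
  "Lambert_W0 = the_inv_into {-1..} (\<lambda>w. w * exp w)"

definition fixpoint_map :: "real ^ 'n ^ 'n \<Rightarrow> real ^ 'n \<Rightarrow> real ^ 'n" where
  "fixpoint_map P x =
     (\<chi> i. exp (Lambert_W0 (1 / P $ i $ i * (\<Sum>j\<in>UNIV. P $ i $ j * rho (x $ i) (x $ j)))))"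

definition positive_vector :: "real ^ 'n \<Rightarrow> bool" where
  "positive_vector x \<longleftrightarrow> (\<forall>i. 0 < x $ i)"

end

theory Submission
  imports Defs
begin

text \<open>
  Put \<open>\<theta>\<^sub>i = exp (1 - q\<^sub>i\<^sub>i)\<close>. Since \<open>1 / rho x y\<close> is the integral of \<open>x powr - s * y powr - (1 - s)\<close> over
  \<open>s \<in> {0..1}\<close>, the chain started in \<open>i\<close> stays there up to time 1 with probability \<open>e / \<theta>\<^sub>i\<close>, and makes
  exactly one jump, to \<open>j\<close>, with probability \<open>q\<^sub>i\<^sub>j * e / rho \<theta>\<^sub>i \<theta>\<^sub>j\<close>. Hence \<open>Q\<close> is a \<open>J\<^sub>1\<close>-generator iff
  its off-diagonal entries are given by the formula in the theorem, and then vanishing of the row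
  sums says \<open>p\<^sub>i\<^sub>i * (\<theta>\<^sub>i * ln \<theta>\<^sub>i) = (\<Sum>j. p\<^sub>i\<^sub>j * rho \<theta>\<^sub>i \<theta>\<^sub>j)\<close>, which is the fixed-point equation. As
  \<open>rho\<close> is monotone and homogeneous of degree 1, comparing two fixed points at the index where their
  ratio is largest gives uniqueness. Existence follows by the Knaster-Tarski argument from the
  monotonicity of the fixed-point map.
\<close>

section \<open>The function rho and the Lambert W function\<close>

lemma rho_self [simp]: "rho x x = x"
  by (simp add: rho_def)

lemma rho_pos:
  assumes "0 < x" "0 < y"
  shows "0 < rho x y"
proof (cases x y rule: linorder_cases)
  case less
  then have "0 < (ln x - ln y) / (x - y)"
    using assms by (intro divide_neg_neg) auto
  then show ?thesis using assms less by (simp only: rho_def mult_pos_pos less_imp_neq if_False)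
next
  case greater
  then have "0 < (ln x - ln y) / (x - y)"
    using assms by (intro divide_pos_pos) auto
  then show ?thesis using assms greater by (simp only: rho_def mult_pos_pos less_imp_neq [symmetric] if_False)
qed (use assms in simp)

lemma rho_scale:
  assumes "0 < c" "0 < x" "0 < y"
  shows "rho (c * x) (c * y) = c * rho x y"
proof (cases "x = y")
  case False
  then have "c * x - c * y = c * (x - y)" "x - y \<noteq> 0"
    by (simp_all add: algebra_simps)
  then show ?thesis
    using assms False by (simp add: rho_def ln_mult)
qed simp

text \<open>For \<open>x \<noteq> y\<close> the integrand divided by \<open>ln y - ln x\<close> is
  an antiderivative; for \<open>x = y\<close> the integrand is constant. The formula serves both the
  monotonicity of \<open>rho\<close> and the law of the first jump.\<close>

lemma has_integral_inverse_rho: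
  assumes "0 < x" "0 < y"
  shows "((\<lambda>s. exp (- (s * ln x + (1 - s) * ln y))) has_integral 1 / rho x y) {0..1}"
proof (cases "x = y")
  case True
  have "- (s * ln y + (1 - s) * ln y) = - ln y" for s
    by (simp add: algebra_simps)
  then show ?thesis
    using True assms has_integral_const_real[of "1 / y" 0 1] by (simp add: exp_minus field_simps)
next
  case False
  define d where "d = ln y - ln x"
  have d: "d \<noteq> 0"
    using assms False by (simp add: d_def)
  let ?F = "\<lambda>s. exp (- (s * ln x + (1 - s) * ln y)) / d"
  have F: "(?F has_real_derivative exp (- (s * ln x + (1 - s) * ln y)) * d / d) (at s within A)" for s A
    by (rule DERIV_cdivide) (auto intro!: derivative_eq_intros simp: d_def)
  have "((\<lambda>s. exp (- (s * ln x + (1 - s) * ln y))) has_integral ?F 1 - ?F 0) {0..1}"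
    using F d by (intro fundamental_theorem_of_calculus)
      (auto simp flip: has_real_derivative_iff_has_vector_derivative)
  also have "?F 1 - ?F 0 = (1 / x - 1 / y) / d"
    using assms by (simp add: exp_minus divide_inverse left_diff_distrib)
  also have "\<dots> = 1 / rho x y"
    using assms False d by (simp add: rho_def d_def field_simps)
  finally show ?thesis .
qed

text \<open>In the integral for \<open>1 / rho x y\<close> the integrand decreases pointwise in both
  \<open>x\<close> and \<open>y\<close>.\<close>

lemma rho_mono:
  assumes "0 < x" "0 < y" "x \<le> x'" "y \<le> y'"
  shows "rho x y \<le> rho x' y'"
proof -
  have "1 / rho x' y' \<le> 1 / rho x y"
  proof (rule has_integral_le [OF has_integral_inverse_rho has_integral_inverse_rho])
    fix s :: real assume "s \<in> {0..1}"
    then show "exp (- (s * ln x' + (1 - s) * ln y')) \<le> exp (- (s * ln x + (1 - s) * ln y))"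
      using assms by (simp only: exp_le_cancel_iff neg_le_iff_le)
        (auto intro!: add_mono mult_left_mono)
  qed (use assms in auto)
  moreover have "0 < rho x y" "0 < rho x' y'"
    using assms by (auto intro!: rho_pos)
  ultimately show ?thesis
    by (simp add: field_simps)
qed

section \<open>The principal branch of the Lambert W function\<close>

lemma strict_mono_on_times_exp: "strict_mono_on {-1..} (\<lambda>w::real. w * exp w)"
proof (rule strict_mono_onI)
  fix r s :: real assume "r \<in> {-1..}" "s \<in> {-1..}" "r < s"
  \<comment> \<open>The derivative \<open>(1 + w) * exp w\<close> vanishes at -1, so its sign is
    used on the open interval only.\<close>
  show "r * exp r < s * exp s"
  proof (rule DERIV_pos_imp_increasing_open [OF \<open>r < s\<close>])
    fix w assume "r < w" "w < s"
    then have "((\<lambda>w. w * exp w) has_real_derivative (1 + w) * exp w) (at w)" "0 < (1 + w) * exp w"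
      using \<open>r \<in> {-1..}\<close> by (auto intro!: derivative_eq_intros mult_pos_pos) (simp add: algebra_simps)
    then show "\<exists>y. ((\<lambda>w. w * exp w) has_real_derivative y) (at w) \<and> 0 < y"
      by blast
  qed (auto intro!: continuous_intros)
qed

lemma Lambert_W0_times_exp:
  assumes "-1 \<le> w"
  shows "Lambert_W0 (w * exp w) = w"
  unfolding Lambert_W0_def
  using the_inv_into_f_f [OF strict_mono_on_imp_inj_on [OF strict_mono_on_times_exp], of w] assms
  by simp

lemma Lambert_W0_nonneg:
  assumes "0 \<le> y"
  shows "0 \<le> Lambert_W0 y" "Lambert_W0 y * exp (Lambert_W0 y) = y"
proof -
  \<comment> \<open>The intermediate value theorem applies on \<open>{0..y}\<close> because
    \<open>0 \<le> y \<le> y * exp y\<close>.\<close>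
  have "\<exists>w\<ge>0. w \<le> y \<and> w * exp w = y"
    by (rule IVT') (use assms in \<open>auto intro!: continuous_intros simp: mult_le_cancel_left1\<close>)
  then obtain w where "0 \<le> w" "w * exp w = y"
    by blast
  with Lambert_W0_times_exp [of w] show "0 \<le> Lambert_W0 y" "Lambert_W0 y * exp (Lambert_W0 y) = y"
    by auto
qed

text \<open>With \<open>w = ln t\<close> the product \<open>w * exp w\<close> becomes
  \<open>t * ln t\<close>. As \<open>0 < y\<close> forces \<open>0 < ln t\<close>, this
  \<open>w\<close> lies on the principal branch.\<close>

lemma exp_Lambert_W0_eq_iff:
  assumes "0 < y" "0 < t"
  shows "exp (Lambert_W0 y) = t \<longleftrightarrow> t * ln t = y"
proof
  assume "exp (Lambert_W0 y) = t"
  then show "t * ln t = y"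
    using Lambert_W0_nonneg(2) [of y] assms by (auto simp: mult.commute)
next
  assume *: "t * ln t = y"
  then have "0 < ln t"
    using assms zero_less_mult_pos by blast
  then have "Lambert_W0 (ln t * exp (ln t)) = ln t"
    by (intro Lambert_W0_times_exp) simp
  then show "exp (Lambert_W0 y) = t"
    using * assms by (simp add: mult.commute)
qed

lemma Lambert_W0_le_iff:
  assumes "0 \<le> y" "-1 \<le> w"
  shows "Lambert_W0 y \<le> w \<longleftrightarrow> y \<le> w * exp w"
  using strict_mono_on_leD [OF strict_mono_on_times_exp, of "Lambert_W0 y" w]
    strict_mono_onD [OF strict_mono_on_times_exp, of w "Lambert_W0 y"]
    Lambert_W0_nonneg [OF assms(1)] assms
  by fastforce

lemma Lambert_W0_mono:
  assumes "0 \<le> y" "y \<le> z"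
  shows "Lambert_W0 y \<le> Lambert_W0 z"
  using Lambert_W0_le_iff [of y "Lambert_W0 z"] Lambert_W0_nonneg [of z] assms by simp

section \<open>Existence and uniqueness of the fixed point\<close>

context
  fixes P :: "real ^ 'n ^ 'n"
  assumes P_stochastic: "stochastic_matrix P"
    and P_diag_pos: "\<And>i. 0 < P $ i $ i"
begin

text \<open>The term \<open>j = i\<close> alone contributes \<open>P $ i $ i * x $ i\<close>, since
  \<open>rho x x = x\<close>, and the other terms are nonnegative.\<close>

lemma rho_row_ge:
  assumes "positive_vector x"
  shows "x $ i \<le> 1 / P $ i $ i * (\<Sum>j\<in>UNIV. P $ i $ j * rho (x $ i) (x $ j))"
proof -
  have "P $ i $ i * rho (x $ i) (x $ i) \<le> (\<Sum>j\<in>UNIV. P $ i $ j * rho (x $ i) (x $ j))"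
    using P_stochastic assms
    by (intro member_le_sum)
       (auto simp: stochastic_matrix_def positive_vector_def intro!: mult_nonneg_nonneg less_imp_le [OF rho_pos])
  then show ?thesis
    using P_diag_pos [of i] by (simp add: field_simps)
qed

lemma rho_row_pos:
  assumes "positive_vector x"
  shows "0 < 1 / P $ i $ i * (\<Sum>j\<in>UNIV. P $ i $ j * rho (x $ i) (x $ j))"
  using rho_row_ge [OF assms, of i] assms unfolding positive_vector_def
  by (meson less_le_trans)

text \<open>Eliminates \<open>Lambert_W0\<close>: in this form fixed points can be compared by
  scaling and matched with vanishing row sums.\<close>

lemma fixpoint_iff:
  assumes "positive_vector x"
  shows "fixpoint_map P x = x \<longleftrightarrow>
    (\<forall>i. P $ i $ i * (x $ i * ln (x $ i)) = (\<Sum>j\<in>UNIV. P $ i $ j * rho (x $ i) (x $ j)))"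
  using exp_Lambert_W0_eq_iff [OF rho_row_pos [OF assms]] assms
    less_imp_neq [OF P_diag_pos]
  by (auto simp: fixpoint_map_def vec_eq_iff positive_vector_def eq_divide_eq ac_simps)

lemma fixpoint_map_mono:
  assumes "positive_vector x" "\<And>i. x $ i \<le> y $ i"
  shows "fixpoint_map P x $ i \<le> fixpoint_map P y $ i"
proof -
  have "(\<Sum>j\<in>UNIV. P $ i $ j * rho (x $ i) (x $ j)) \<le> (\<Sum>j\<in>UNIV. P $ i $ j * rho (y $ i) (y $ j))"
    using P_stochastic assms unfolding stochastic_matrix_def positive_vector_def
    by (intro sum_mono mult_left_mono rho_mono) auto
  then show ?thesis
    using P_diag_pos [of i] rho_row_pos [OF assms(1), of i] unfolding fixpoint_map_def
    by (auto intro!: Lambert_W0_mono divide_right_mono)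
qed

text \<open>At an index maximising \<open>x $ i / y $ i = c\<close>, homogeneity and monotonicity of \<open>rho\<close> give
  \<open>x $ i * ln (x $ i) \<le> c * (y $ i * ln (y $ i))\<close>, hence \<open>c \<le> 1\<close>.\<close>

lemma fixpoint_le:
  assumes x: "positive_vector x" "fixpoint_map P x = x"
    and y: "positive_vector y" "fixpoint_map P y = y"
  shows "x $ k \<le> y $ k"
proof -
  have pos: "0 < x $ j" "0 < y $ j" for j
    using x y by (auto simp: positive_vector_def)
  have "finite (range (\<lambda>j. x $ j / y $ j))"
    by simp
  then obtain i where i: "Max (range (\<lambda>j. x $ j / y $ j)) = x $ i / y $ i"
    by (metis (no_types, lifting) Max_in UNIV_not_empty image_iff image_is_empty)
  define c where "c = x $ i / y $ i"
  have le: "x $ j / y $ j \<le> c" for j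
    using i by (auto simp: c_def intro!: Max_ge simp flip: i)
  have cy: "x $ j \<le> c * y $ j" for j
    using le [of j] pos [of j] by (simp add: pos_divide_le_eq)
  have c: "0 < c" "x $ i = c * y $ i"
    using pos [of i] by (simp_all add: c_def)
  have "P $ i $ i * (x $ i * ln (x $ i)) = (\<Sum>j\<in>UNIV. P $ i $ j * rho (x $ i) (x $ j))"
    using x fixpoint_iff by blast
  also have "\<dots> \<le> (\<Sum>j\<in>UNIV. P $ i $ j * rho (c * y $ i) (c * y $ j))"
    using P_stochastic cy pos unfolding stochastic_matrix_def
    by (intro sum_mono mult_left_mono rho_mono) auto
  also have "\<dots> = c * (\<Sum>j\<in>UNIV. P $ i $ j * rho (y $ i) (y $ j))"
    using pos c by (simp add: rho_scale sum_distrib_left mult.left_commute)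
  also have "\<dots> = c * (P $ i $ i * (y $ i * ln (y $ i)))"
    using y fixpoint_iff by metis
  also have "\<dots> = P $ i $ i * (x $ i * ln (y $ i))"
    using c by simp
  \<comment> \<open>Both sides carry the positive factor \<open>P $ i $ i * x $ i\<close>, so only
    the logarithms remain to be compared.\<close>
  finally have "ln (x $ i) \<le> ln (y $ i)"
    using pos P_diag_pos by simp
  then have "c \<le> 1"
    using pos by (simp add: c_def)
  then show ?thesis
    using cy [of k] pos [of k] by (meson mult_left_le_one_le order_trans less_imp_le c(1))
qed

text \<open>The coordinatewise supremum of the vectors that lie between \<open>exp 1\<close> and
  \<open>M\<close> and below their own image is a fixed point, because the map is monotone and sends
  this set into itself.\<close>

lemma fixpoint_exists: "\<exists>x. positive_vector x \<and> fixpoint_map P x = x"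
proof -
  \<comment> \<open>The bound \<open>Lambert_W0 (M / P $ i $ i) \<le> ln M\<close> amounts to
    \<open>1 / P $ i $ i \<le> ln M\<close>; the sum of the reciprocals serves every
    \<open>i\<close> at once.\<close>
  define M where "M = exp (\<Sum>i\<in>UNIV. 1 / P $ i $ i)"
  \<comment> \<open>The lower bound keeps vectors positive, as the monotonicity of
    \<open>rho\<close> requires; the upper bound makes the suprema exist.\<close>
  define S where "S = {x. (\<forall>i. exp 1 \<le> x $ i \<and> x $ i \<le> M) \<and> (\<forall>i. x $ i \<le> fixpoint_map P x $ i)}"
  have pos: "positive_vector x" if "\<And>i. exp 1 \<le> x $ i" for x :: "real ^ 'n"
    using that by (auto simp: positive_vector_def intro: less_le_trans [OF exp_gt_zero])
  have row: "(\<Sum>j\<in>UNIV. P $ i $ j) = 1" for i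
    using P_stochastic by (simp add: stochastic_matrix_def)
  have diag_le: "P $ i $ i \<le> 1" for i
    using member_le_sum [of i UNIV "\<lambda>j. P $ i $ j"] P_stochastic row [of i]
    by (simp add: stochastic_matrix_def)
  have recip_le: "1 / P $ i $ i \<le> (\<Sum>i\<in>UNIV. 1 / P $ i $ i)" for i
    by (rule member_le_sum) (auto intro: less_imp_le [OF P_diag_pos])
  have "1 \<le> 1 / P $ i $ i" for i
    using diag_le P_diag_pos by simp
  then have M: "exp 1 \<le> M"
    unfolding M_def using recip_le by (metis exp_le_cancel_iff order_trans)
  \<comment> \<open>On a constant vector \<open>rho\<close> returns the constant, and the row sum is
    1.\<close>
  have const: "fixpoint_map P (\<chi> i. c) $ i = exp (Lambert_W0 (c / P $ i $ i))" for c i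
    using row by (simp add: fixpoint_map_def sum_distrib_right [symmetric])
  have T_le: "fixpoint_map P x $ i \<le> M" if "x \<in> S" for x i
  proof -
    have "fixpoint_map P x $ i \<le> fixpoint_map P (\<chi> i. M) $ i"
      using that pos by (intro fixpoint_map_mono) (auto simp: S_def)
    also have "Lambert_W0 (M / P $ i $ i) \<le> ln M"
      using recip_le [of i] P_diag_pos [of i]
      by (subst Lambert_W0_le_iff)
        (auto simp: M_def sum_nonneg less_imp_le [OF P_diag_pos] field_simps intro: order_trans [of _ 0])
    then have "fixpoint_map P (\<chi> i. M) $ i \<le> M"
      unfolding const by (simp add: M_def)
    finally show ?thesis .
  qed
  \<comment> \<open>From \<open>P $ i $ i \<le> 1\<close> the argument of \<open>Lambert_W0\<close>
    is at least \<open>exp 1 = 1 * exp 1\<close>, so its value is at least 1. Thus \<open>S\<close>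
    is nonempty.\<close>
  have bot: "(\<chi> i. exp 1) \<in> S"
  proof -
    have "1 \<le> Lambert_W0 (exp 1 / P $ i $ i)" for i
    proof -
      have "Lambert_W0 (1 * exp 1) \<le> Lambert_W0 (exp 1 / P $ i $ i)"
        using P_diag_pos [of i] diag_le [of i] by (intro Lambert_W0_mono) (auto simp: field_simps)
      then show ?thesis
        using Lambert_W0_times_exp [of 1] by simp
    qed
    then show ?thesis
      using M by (simp add: S_def const)
  qed
  define a where "a = (\<chi> i. SUP x\<in>S. x $ i)"
  have bdd: "bdd_above ((\<lambda>x. x $ i) ` S)" for i
    by (rule bdd_aboveI [of _ M]) (auto simp: S_def)
  have upper: "x $ i \<le> a $ i" if "x \<in> S" for x i
    using that bdd [of i] by (auto simp: a_def intro!: cSUP_upper)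
  have least: "a $ i \<le> b" if "\<And>x. x \<in> S \<Longrightarrow> x $ i \<le> b" for i b
    using that bot by (auto simp: a_def intro!: cSUP_least)
  have a_ge: "exp 1 \<le> a $ i" for i
    using upper [OF bot, of i] by simp
  have a_T: "a $ i \<le> fixpoint_map P a $ i" for i
  proof (rule least)
    fix x assume "x \<in> S"
    then have "x $ i \<le> fixpoint_map P x $ i"
      by (simp add: S_def)
    also have "fixpoint_map P x $ i \<le> fixpoint_map P a $ i"
      using \<open>x \<in> S\<close> upper pos by (intro fixpoint_map_mono) (auto simp: S_def)
    finally show "x $ i \<le> fixpoint_map P a $ i" .
  qed
  have "a \<in> S"
    using a_ge a_T least by (auto simp: S_def)
  \<comment> \<open>Membership in \<open>S\<close> puts the image of \<open>a\<close> below the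
    supremum \<open>a\<close>; the reverse inequality is \<open>a_T\<close>.\<close>
  have "fixpoint_map P a \<in> S"
    using T_le [OF \<open>a \<in> S\<close>] order_trans [OF a_ge a_T] fixpoint_map_mono [OF pos [OF a_ge] a_T]
    by (auto simp: S_def)
  then have "fixpoint_map P a = a"
    using a_T upper by (auto simp: vec_eq_iff intro: antisym)
  then show ?thesis
    using pos a_ge by blast
qed

end

section \<open>The chain up to its second jump\<close>

text \<open>Two distinct coordinates of a product measure are independent: the preimage of a
  rectangle is a cylinder over \<open>{a, b}\<close>, whose measure factorises.\<close>

lemma distr_PiM_pair:
  assumes M: "\<And>i. i \<in> I \<Longrightarrow> prob_space (M i)"
    and ab: "a \<in> I" "b \<in> I" "a \<noteq> b"
  shows "distr (PiM I M) (M a \<Otimes>\<^sub>M M b) (\<lambda>\<omega>. (\<omega> a, \<omega> b)) = M a \<Otimes>\<^sub>M M b"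
proof (rule pair_measure_eqI [symmetric])
  fix A B assume AB: "A \<in> sets (M a)" "B \<in> sets (M b)"
  define F where "F = (\<lambda>i. if i = a then A else B)"
  have F: "F i \<in> sets (M i)" if "i \<in> {a, b}" for i
    using that AB ab by (auto simp: F_def)
  have "(\<lambda>\<omega>. (\<omega> a, \<omega> b)) -` (A \<times> B) \<inter> space (PiM I M) = prod_emb I M {a, b} (Pi\<^sub>E {a, b} F)"
    using ab by (auto simp: prod_emb_def space_PiM F_def)
  also have "emeasure (PiM I M) \<dots> = (\<Prod>i\<in>{a, b}. emeasure (M i) (F i))"
    using M F ab by (intro emeasure_PiM_emb) auto
  also have "\<dots> = emeasure (M a) A * emeasure (M b) B"
    using ab by (simp add: F_def)
  finally show "emeasure (M a) A * emeasure (M b) B =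
      emeasure (distr (PiM I M) (M a \<Otimes>\<^sub>M M b) (\<lambda>\<omega>. (\<omega> a, \<omega> b))) (A \<times> B)"
    using AB ab by (subst emeasure_distr) auto
qed (use M ab in \<open>auto intro!: prob_space_imp_sigma_finite\<close>)

section \<open>Measurability of the chain and of its jump counts\<close>

lemma sets_holding_measure [measurable_cong]: "sets (holding_measure Q i) = sets borel"
  by (simp add: holding_measure_def)

lemma space_holding_measure [simp]: "space (holding_measure Q i) = UNIV"
  by (simp add: holding_measure_def)

text \<open>The sigma-algebra does not depend on \<open>Q\<close>, so measurability can be checked
  in one fixed product space.\<close>

lemma sets_chain_measure [measurable_cong]:
  "sets (chain_measure Q) = sets (PiM UNIV (\<lambda>_. borel \<Otimes>\<^sub>M count_space UNIV))"
  unfolding chain_measure_def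
  by (intro sets_PiM_cong) (auto intro!: sets_pair_measure_cong simp: sets_holding_measure)

lemma measurable_chain_component [measurable]:
  "(\<lambda>\<omega>. fst (\<omega> p)) \<in> borel_measurable (chain_measure Q)"
  "(\<lambda>\<omega>. snd (\<omega> p)) \<in> chain_measure Q \<rightarrow>\<^sub>M count_space UNIV"
  by measurable

text \<open>The coordinate that is read is itself random, but it takes only countably many
  values.\<close>

lemma measurable_visited_state [measurable]:
  "visited_state i k \<in> chain_measure Q \<rightarrow>\<^sub>M count_space UNIV"
proof (induction k)
  case (Suc k)
  have "(\<lambda>\<omega>. snd (\<omega> (k, visited_state i k \<omega>))) \<in> chain_measure Q \<rightarrow>\<^sub>M count_space UNIV"
    by (rule measurable_compose_countable [OF measurable_chain_component(2) Suc])
  then show ?case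
    by (simp cong: measurable_cong)
qed (simp cong: measurable_cong)

lemma borel_measurable_holding_time [measurable]:
  "holding_time i k \<in> borel_measurable (chain_measure Q)"
  unfolding holding_time_def
  by (rule measurable_compose_countable [OF measurable_chain_component(1) measurable_visited_state])

lemma borel_measurable_jump_time [measurable]:
  "jump_time i k \<in> borel_measurable (chain_measure Q)"
  unfolding jump_time_def by measurable

lemma num_jumps_le_iff: "num_jumps i t \<omega> \<le> enat n \<longleftrightarrow> (\<forall>k. jump_time i k \<omega> \<le> ereal t \<longrightarrow> k \<le> n)"
  by (auto simp: num_jumps_def SUP_le_iff)

text \<open>With at most one jump the count is finite, so \<open>the_enat\<close> is meaningful and
  only the first two visited states occur.\<close>

lemma chain_state_at_most_one_jump:
  "chain_state i t \<omega> = j \<and> num_jumps i t \<omega> \<le> 1 \<longleftrightarrow>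
     num_jumps i t \<omega> \<le> enat 0 \<and> i = j \<or>
     \<not> num_jumps i t \<omega> \<le> enat 0 \<and> num_jumps i t \<omega> \<le> enat 1 \<and> visited_state i 1 \<omega> = j"
  by (cases "num_jumps i t \<omega>") (auto simp: chain_state_def one_enat_def le_Suc_eq)

lemma measurable_num_jumps_le [measurable]:
  "Measurable.pred (chain_measure Q) (\<lambda>\<omega>. num_jumps i t \<omega> \<le> enat n)"
  unfolding num_jumps_le_iff by measurable

lemma measurable_chain_state_at_most_one_jump [measurable]:
  "Measurable.pred (chain_measure Q) (\<lambda>\<omega>. chain_state i t \<omega> = j \<and> num_jumps i t \<omega> \<le> 1)"
  unfolding chain_state_at_most_one_jump by measurable

section \<open>Holding times and the paths with at most one jump\<close>

lemma AE_holding_measure_nonneg: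
  assumes "Q $ i $ i \<le> 0"
  shows "AE t in holding_measure Q i. 0 \<le> t"
proof (cases "Q $ i $ i < 0")
  case True
  have "AE t in distr (density lborel (exponential_density (- Q $ i $ i))) borel ereal. 0 \<le> t"
    by (subst AE_distr_iff) (auto simp: AE_density exponential_density_def)
  with True show ?thesis
    unfolding holding_measure_def by (simp only: if_True)
next
  case False
  then show ?thesis
    unfolding holding_measure_def by (simp only: if_False) (simp add: AE_return)
qed

text \<open>One formula covers both kinds of state: if \<open>Q $ i $ i = 0\<close>, the holding
  time is infinite and both sides are 1.\<close>

lemma emeasure_holding_measure_gt:
  assumes "Q $ i $ i \<le> 0" "0 \<le> r"
  shows "emeasure (holding_measure Q i) {ereal r<..} = ennreal (exp (Q $ i $ i * r))"
proof (cases "Q $ i $ i < 0")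
  case True
  let ?l = "- Q $ i $ i"
  let ?D = "density lborel (exponential_density ?l)"
  interpret D: prob_space ?D
    using True by (intro prob_space_exponential_density) simp
  have "distributed ?D lborel (\<lambda>x. x) (exponential_density ?l)"
    by (auto simp: distributed_def distr_id2)
  then have "measure ?D {x \<in> space ?D. r < x} = exp (- r * ?l)"
    using True assms by (intro D.exponential_distributedD_gt) auto
  moreover have "emeasure (holding_measure Q i) {ereal r<..} = emeasure ?D {x \<in> space ?D. r < x}"
    using True by (simp add: holding_measure_def emeasure_distr vimage_def)
  ultimately show ?thesis
    by (simp add: D.emeasure_eq_measure mult.commute)
next
  case False
  then show ?thesis
    using assms by (simp add: holding_measure_def)
qed

text \<open>Once the first successor is known to be \<open>j\<close>, the second holding time sits
  at the fixed coordinate \<open>(1, j)\<close>. The event thus involves two deterministic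
  coordinates instead of a random one.\<close>

lemma chain_path_at_most_one_jump:
  assumes nonneg: "\<forall>p. 0 \<le> fst (\<omega> p)"
  shows "chain_state i 1 \<omega> = j \<and> num_jumps i 1 \<omega> \<le> 1 \<longleftrightarrow>
    1 < fst (\<omega> (0, i)) \<and> i = j \<or>
    0 \<le> fst (\<omega> (0, i)) \<and> fst (\<omega> (0, i)) \<le> 1 \<and> snd (\<omega> (0, i)) = j \<and>
      1 < fst (\<omega> (0, i)) + fst (\<omega> (1, j))"
proof -
  have mono: "jump_time i k \<omega> \<le> jump_time i l \<omega>" if "k \<le> l" for k l
    unfolding jump_time_def using that nonneg by (intro sum_mono2) (auto simp: holding_time_def)
  \<comment> \<open>Jump times increase with their index, so at most \<open>n\<close> jumps occur up
    to time 1 iff the jump with number \<open>Suc n\<close> comes strictly later.\<close>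
  have le_iff: "num_jumps i 1 \<omega> \<le> enat n \<longleftrightarrow> 1 < jump_time i (Suc n) \<omega>" for n
  proof -
    have "(\<forall>k. jump_time i k \<omega> \<le> 1 \<longrightarrow> k \<le> n) \<longleftrightarrow> 1 < jump_time i (Suc n) \<omega>"
      using mono by (metis not_less not_less_eq_eq order_refl order_trans)
    then show ?thesis
      by (simp add: num_jumps_le_iff one_ereal_def)
  qed
  have t: "jump_time i (Suc 0) \<omega> = fst (\<omega> (0, i))"
    "jump_time i (Suc 1) \<omega> = fst (\<omega> (0, i)) + fst (\<omega> (1, snd (\<omega> (0, i))))"
    by (simp_all add: jump_time_def holding_time_def)
  have "fst (\<omega> (0, i)) \<le> fst (\<omega> (0, i)) + fst (\<omega> (1, snd (\<omega> (0, i))))"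
    using nonneg by (simp add: ereal_le_add_self)
  then show ?thesis
    unfolding chain_state_at_most_one_jump le_iff t
    using nonneg by (auto simp: not_less)
qed

section \<open>Probabilities of no jump and of exactly one jump\<close>

context
  fixes Q :: "real ^ 'n ^ 'n"
  assumes Q: "intensity_matrix Q"
begin

lemma intensity_diag_le_0: "Q $ i $ i \<le> 0"
proof -
  have "(\<Sum>j\<in>UNIV. Q $ i $ j) = Q $ i $ i + (\<Sum>j\<in>UNIV - {i}. Q $ i $ j)"
    by (simp add: sum.remove)
  moreover have "0 \<le> (\<Sum>j\<in>UNIV - {i}. Q $ i $ j)"
    using Q by (intro sum_nonneg) (auto simp: intensity_matrix_def)
  ultimately show ?thesis
    using Q by (simp add: intensity_matrix_def)
qed

lemma intensity_absorbing:
  assumes "Q $ i $ i = 0"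
  shows "Q $ i $ j = 0"
proof (cases "j = i")
  case False
  have "(\<Sum>j\<in>UNIV. Q $ i $ j) = Q $ i $ i + (\<Sum>j\<in>UNIV - {i}. Q $ i $ j)"
    by (simp add: sum.remove)
  then have "(\<Sum>j\<in>UNIV - {i}. Q $ i $ j) = 0"
    using Q assms by (simp add: intensity_matrix_def)
  moreover have "\<And>j. j \<in> UNIV - {i} \<Longrightarrow> 0 \<le> Q $ i $ j"
    using Q by (auto simp: intensity_matrix_def)
  ultimately show ?thesis
    using False by (subst (asm) sum_nonneg_eq_0_iff) auto
qed (use assms in simp)

interpretation C: prob_space "chain_measure Q"
  by (rule prob_space_chain_measure)

lemma prob_space_step:
  "prob_space (case p of (k, i) \<Rightarrow> holding_measure Q i \<Otimes>\<^sub>M measure_pmf (jump_pmf Q i))"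
  by (auto split: prod.split
      intro!: prob_space_pair prob_space_holding_measure prob_space_measure_pmf)

lemma AE_chain_times_nonneg: "AE \<omega> in chain_measure Q. \<forall>p. 0 \<le> fst (\<omega> p)"
proof -
  have "AE \<omega> in chain_measure Q. 0 \<le> fst (\<omega> p)" for p
  proof -
    obtain k i where p: "p = (k, i)"
      by fastforce
    interpret pair_prob_space "holding_measure Q i" "measure_pmf (jump_pmf Q i)"
      by (simp add: pair_prob_space_def pair_sigma_finite_def prob_space_imp_sigma_finite
          prob_space_holding_measure prob_space_measure_pmf)
    have "AE u in holding_measure Q i \<Otimes>\<^sub>M measure_pmf (jump_pmf Q i). 0 \<le> fst u"
      using AE_holding_measure_nonneg [OF intensity_diag_le_0, of i]
      by (intro AE_pair_measure) auto
    then show ?thesis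
      using prob_space_step unfolding chain_measure_def p
      by (intro AE_PiM_component) auto
  qed
  then show ?thesis
    by (simp add: AE_all_countable)
qed

lemma emeasure_no_jump:
  "emeasure (chain_measure Q) {\<omega> \<in> space (chain_measure Q). 1 < fst (\<omega> (0, i))} = ennreal (exp (Q $ i $ i))"
proof -
  let ?M = "\<lambda>(k::nat, i). holding_measure Q i \<Otimes>\<^sub>M measure_pmf (jump_pmf Q i)"
  let ?N = "holding_measure Q i \<Otimes>\<^sub>M measure_pmf (jump_pmf Q i)"
  have proj: "(\<lambda>\<omega>. \<omega> (0, i)) \<in> chain_measure Q \<rightarrow>\<^sub>M ?N"
    unfolding chain_measure_def using measurable_component_singleton [of "(0, i)" UNIV ?M] by simp
  have "?N = distr (chain_measure Q) ?N (\<lambda>\<omega>. \<omega> (0, i))"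
    using distr_PiM_component [of UNIV ?M "(0, i)", OF prob_space_step] by (simp add: chain_measure_def)
  then have "emeasure ?N ({1<..} \<times> UNIV) =
      emeasure (distr (chain_measure Q) ?N (\<lambda>\<omega>. \<omega> (0, i))) ({1<..} \<times> UNIV)"
    by simp
  also have "\<dots> =
      emeasure (chain_measure Q) ((\<lambda>\<omega>. \<omega> (0, i)) -` ({1<..} \<times> UNIV) \<inter> space (chain_measure Q))"
    by (rule emeasure_distr [OF proj]) (auto simp: sets_holding_measure intro!: pair_measureI)
  also have "(\<lambda>\<omega>. \<omega> (0, i)) -` ({1<..} \<times> UNIV) \<inter> space (chain_measure Q) =
      {\<omega> \<in> space (chain_measure Q). 1 < fst (\<omega> (0, i))}"
    by (auto simp: mem_Times_iff)
  also have "emeasure ?N ({1<..} \<times> UNIV) = emeasure (holding_measure Q i) {1<..}"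
    using measure_pmf.emeasure_space_1 by (subst measure_pmf.emeasure_pair_measure_Times) (auto simp: sets_holding_measure)
  also have "\<dots> = ennreal (exp (Q $ i $ i))"
    using emeasure_holding_measure_gt [OF intensity_diag_le_0, of 1 i] by (simp add: one_ereal_def)
  finally show ?thesis
    by simp
qed

text \<open>The density of a first jump at time \<open>s\<close> is weighted with the probability
  that state \<open>j\<close> lasts for the remaining time \<open>1 - s\<close>. As
  \<open>s + (1 - s) = 1\<close>, a factor \<open>exp 1\<close> can be split off, which leaves the
  integrand of \<open>has_integral_inverse_rho\<close>.\<close>

lemma nn_integral_first_jump:
  "(\<integral>\<^sup>+ s. indicator {0..1} s * ennreal (exp (Q $ j $ j * (1 - real_of_ereal s))) \<partial>holding_measure Q i) =
    ennreal (- Q $ i $ i * exp 1 / rho (exp (1 - Q $ i $ i)) (exp (1 - Q $ j $ j)))"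
proof (cases "Q $ i $ i < 0")
  case True
  let ?r = "rho (exp (1 - Q $ i $ i)) (exp (1 - Q $ j $ j))"
  let ?g = "\<lambda>s. exp (- (s * ln (exp (1 - Q $ i $ i)) + (1 - s) * ln (exp (1 - Q $ j $ j))))"
  have g: "((\<lambda>s. - Q $ i $ i * exp 1 * ?g s) has_integral - Q $ i $ i * exp 1 * (1 / ?r)) {0..1}"
    by (intro has_integral_mult_right has_integral_inverse_rho) auto
  have eq: "exponential_density (- Q $ i $ i) s * exp (Q $ j $ j * (1 - s)) = - Q $ i $ i * exp 1 * ?g s"
    if "0 \<le> s" for s
    using that by (simp add: exponential_density_def mult_exp_exp algebra_simps)
  have "(\<integral>\<^sup>+ s. indicator {0..1} s * ennreal (exp (Q $ j $ j * (1 - real_of_ereal s))) \<partial>holding_measure Q i) =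
      (\<integral>\<^sup>+ s. ennreal (exponential_density (- Q $ i $ i) s) *
        (indicator {0..1} (ereal s) * ennreal (exp (Q $ j $ j * (1 - s)))) \<partial>lborel)"
    using True by (simp add: holding_measure_def nn_integral_distr nn_integral_density)
  also have "\<dots> = (\<integral>\<^sup>+ s. ennreal (indicator {0..1} s * (- Q $ i $ i * exp 1 * ?g s)) \<partial>lborel)"
  proof (rule nn_integral_cong)
    fix s :: real
    show "ennreal (exponential_density (- Q $ i $ i) s) *
        (indicator {0..1} (ereal s) * ennreal (exp (Q $ j $ j * (1 - s)))) =
      ennreal (indicator {0..1} s * (- Q $ i $ i * exp 1 * ?g s))"
      using eq [of s] True
      by (auto simp: indicator_def exponential_density_nonneg simp flip: ennreal_mult)
  qed
  also have "\<dots> = ennreal (- Q $ i $ i * exp 1 * (1 / ?r))"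
    using True by (intro nn_integral_has_integral_lebesgue g) (auto simp: mult_nonpos_nonneg)
  finally show ?thesis
    by simp
next
  case False
  then show ?thesis
    using intensity_diag_le_0 [of i] by (simp add: holding_measure_def nn_integral_return)
qed

text \<open>Fubini over the first holding time and successor; the slice over each such pair is a
  survival event of state \<open>j\<close>.\<close>

lemma emeasure_one_jump:
  "emeasure (chain_measure Q)
      {\<omega> \<in> space (chain_measure Q). 0 \<le> fst (\<omega> (0, i)) \<and> fst (\<omega> (0, i)) \<le> 1 \<and> snd (\<omega> (0, i)) = j \<and>
        1 < fst (\<omega> (0, i)) + fst (\<omega> (1, j))} =
    ennreal (- Q $ i $ i * exp 1 / rho (exp (1 - Q $ i $ i)) (exp (1 - Q $ j $ j))) *
    ennreal (pmf (jump_pmf Q i) j)" (is "emeasure _ ?X = ?R")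
proof -
  let ?M = "\<lambda>(k::nat, i). holding_measure Q i \<Otimes>\<^sub>M measure_pmf (jump_pmf Q i)"
  let ?A = "holding_measure Q i \<Otimes>\<^sub>M measure_pmf (jump_pmf Q i)"
  let ?B = "holding_measure Q j \<Otimes>\<^sub>M measure_pmf (jump_pmf Q j)"
  define E where "E = {(u, v). 0 \<le> fst u \<and> fst u \<le> 1 \<and> snd u = j \<and> 1 < fst u + fst (v :: ereal \<times> 'n)}"
  define f where "f = (\<lambda>s. indicator {0..1} s * ennreal (exp (Q $ j $ j * (1 - real_of_ereal s))))"
  have f [measurable]: "f \<in> borel_measurable borel"
    unfolding f_def by measurable
  interpret B: prob_space ?B
    by (intro prob_space_pair prob_space_holding_measure prob_space_measure_pmf)
  have proj: "(\<lambda>\<omega>. (\<omega> (0, i), \<omega> (1, j))) \<in> chain_measure Q \<rightarrow>\<^sub>M ?A \<Otimes>\<^sub>M ?B"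
    unfolding chain_measure_def
    using measurable_component_singleton [of "(0, i)" UNIV ?M]
      measurable_component_singleton [of "(1, j)" UNIV ?M]
    by (intro measurable_Pair) auto
  have "E = {w \<in> space (?A \<Otimes>\<^sub>M ?B). 0 \<le> fst (fst w) \<and> fst (fst w) \<le> 1 \<and> snd (fst w) = j \<and>
      1 < fst (fst w) + fst (snd w)}"
    by (auto simp: E_def space_pair_measure)
  also have "\<dots> \<in> sets (?A \<Otimes>\<^sub>M ?B)"
    by measurable
  finally have E: "E \<in> sets (?A \<Otimes>\<^sub>M ?B)" .
  have slice: "emeasure ?B (Pair u -` E) = f (fst u) * indicator {j} (snd u)" for u
  proof (cases "0 \<le> fst u \<and> fst u \<le> 1 \<and> snd u = j")
    case True
    then obtain s where s: "fst u = ereal s" "0 \<le> s" "s \<le> 1"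
      by (cases "fst u") (auto simp: one_ereal_def)
    \<comment> \<open>The first holding time is a finite real here, so it can be moved across the
      inequality even if the second one is infinite.\<close>
    have shift: "1 < ereal s + t \<longleftrightarrow> ereal (1 - s) < t" for t
      by (cases t) (auto simp: one_ereal_def)
    have "(u, v) \<in> E \<longleftrightarrow> 1 < fst u + fst v" for v
      using True by (simp add: E_def)
    then have "Pair u -` E = {ereal (1 - s)<..} \<times> UNIV"
      unfolding s(1) shift by auto
    then have "emeasure ?B (Pair u -` E) =
        emeasure (holding_measure Q j) {ereal (1 - s)<..} * emeasure (measure_pmf (jump_pmf Q j)) UNIV"
      by (simp only:) (rule measure_pmf.emeasure_pair_measure_Times, auto simp: sets_holding_measure)
    also have "\<dots> = emeasure (holding_measure Q j) {ereal (1 - s)<..}"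
      using measure_pmf.emeasure_space_1 [of "jump_pmf Q j"] by simp
    also have "\<dots> = ennreal (exp (Q $ j $ j * (1 - s)))"
      using s by (intro emeasure_holding_measure_gt intensity_diag_le_0) simp
    finally show ?thesis
      using True s by (simp add: f_def)
  next
    case False
    then have "Pair u -` E = {}"
      by (auto simp: E_def)
    then show ?thesis
      using False by (auto simp: f_def indicator_def)
  qed
  have "emeasure (chain_measure Q) ?X =
      emeasure (chain_measure Q) ((\<lambda>\<omega>. (\<omega> (0, i), \<omega> (1, j))) -` E \<inter> space (chain_measure Q))"
    by (intro arg_cong2 [where f = emeasure]) (auto simp: E_def)
  also have "\<dots> = emeasure (distr (chain_measure Q) (?A \<Otimes>\<^sub>M ?B) (\<lambda>\<omega>. (\<omega> (0, i), \<omega> (1, j)))) E"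
    by (rule emeasure_distr [OF proj E, symmetric])
  \<comment> \<open>The step numbers 0 and 1 keep the two coordinates distinct even if
    \<open>i = j\<close>.\<close>
  also have "distr (chain_measure Q) (?A \<Otimes>\<^sub>M ?B) (\<lambda>\<omega>. (\<omega> (0, i), \<omega> (1, j))) = ?A \<Otimes>\<^sub>M ?B"
    using distr_PiM_pair [of UNIV ?M "(0, i)" "(1, j)", OF prob_space_step] by (simp add: chain_measure_def)
  also have "emeasure (?A \<Otimes>\<^sub>M ?B) E = (\<integral>\<^sup>+ u. f (fst u) * indicator {j} (snd u) \<partial>?A)"
    by (simp add: B.emeasure_pair_measure_alt [OF E] slice)
  also have "\<dots> = (\<integral>\<^sup>+ s. \<integral>\<^sup>+ k. f s * indicator {j} k \<partial>jump_pmf Q i \<partial>holding_measure Q i)"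
    by (subst measure_pmf.nn_integral_fst [symmetric]) auto
  also have "\<dots> = (\<integral>\<^sup>+ s. f s * ennreal (pmf (jump_pmf Q i) j) \<partial>holding_measure Q i)"
    by (simp add: nn_integral_cmult emeasure_pmf_single)
  also have "\<dots> = (\<integral>\<^sup>+ s. f s \<partial>holding_measure Q i) * ennreal (pmf (jump_pmf Q i) j)"
    by (rule nn_integral_multc) simp
  finally show ?thesis
    unfolding f_def nn_integral_first_jump .
qed

text \<open>Outside the null event of a negative holding time, the event is the disjoint union of
  \<open>X\<close> (no jump) and \<open>Y\<close> (one jump, to \<open>j\<close>).\<close>

lemma measure_at_most_one_jump:
  "measure (chain_measure Q) {\<omega> \<in> space (chain_measure Q). chain_state i 1 \<omega> = j \<and> num_jumps i 1 \<omega> \<le> 1} =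
    (if i = j then exp (Q $ i $ i) else Q $ i $ j * exp 1 / rho (exp (1 - Q $ i $ i)) (exp (1 - Q $ j $ j)))"
proof -
  let ?M = "chain_measure Q"
  define X where "X = {\<omega> \<in> space ?M. 1 < fst (\<omega> (0, i)) \<and> i = j}"
  define Y where "Y = {\<omega> \<in> space ?M. 0 \<le> fst (\<omega> (0, i)) \<and> fst (\<omega> (0, i)) \<le> 1 \<and> snd (\<omega> (0, i)) = j \<and>
      1 < fst (\<omega> (0, i)) + fst (\<omega> (1, j))}"
  let ?y = "if i = j then 0 else Q $ i $ j * exp 1 / rho (exp (1 - Q $ i $ i)) (exp (1 - Q $ j $ j))"
  have [measurable]: "X \<in> sets ?M" "Y \<in> sets ?M"
    unfolding X_def Y_def by measurable
  have "C.prob {\<omega> \<in> space ?M. chain_state i 1 \<omega> = j \<and> num_jumps i 1 \<omega> \<le> 1} = C.prob (X \<union> Y)"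
  proof (rule C.finite_measure_eq_AE)
    show "AE \<omega> in ?M. (\<omega> \<in> {\<omega> \<in> space ?M. chain_state i 1 \<omega> = j \<and> num_jumps i 1 \<omega> \<le> 1}) = (\<omega> \<in> X \<union> Y)"
      using AE_chain_times_nonneg
    proof (rule AE_mp, intro AE_I2 impI)
      fix \<omega> assume "\<omega> \<in> space ?M" "\<forall>p. 0 \<le> fst (\<omega> p)"
      with chain_path_at_most_one_jump [of \<omega> i j]
      show "(\<omega> \<in> {\<omega> \<in> space ?M. chain_state i 1 \<omega> = j \<and> num_jumps i 1 \<omega> \<le> 1}) = (\<omega> \<in> X \<union> Y)"
        by (simp add: X_def Y_def)
    qed
  qed measurable
  also have "\<dots> = C.prob X + C.prob Y"
    by (rule C.finite_measure_Union) (auto simp: X_def Y_def)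
  also have "C.prob X = (if i = j then exp (Q $ i $ i) else 0)"
    using emeasure_no_jump [of i] by (cases "i = j") (simp_all add: X_def measure_def)
  also have "C.prob Y = ?y"
  proof -
    let ?r = "rho (exp (1 - Q $ i $ i)) (exp (1 - Q $ j $ j))"
    have "0 < ?r"
      by (intro rho_pos) auto
    have "emeasure ?M Y = ennreal (- Q $ i $ i * exp 1 / ?r * pmf (jump_pmf Q i) j)"
      unfolding Y_def emeasure_one_jump by (rule ennreal_mult'' [symmetric]) simp
    \<comment> \<open>The exit rate cancels against the denominator of the jump probability, which
      is 0 for \<open>j = i\<close>. In an absorbing state the whole row of \<open>Q\<close>
      vanishes, and so do both sides.\<close>
    also have "- Q $ i $ i * exp 1 / ?r * pmf (jump_pmf Q i) j = ?y"
      using intensity_diag_le_0 [of i] intensity_absorbing [of i j] pmf_jump_pmf [OF Q, of i j]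
      by (cases "Q $ i $ i = 0") auto
    finally have "emeasure ?M Y = ennreal ?y" .
    moreover have "0 \<le> ?y"
      using Q \<open>0 < ?r\<close> by (simp add: intensity_matrix_def)
    ultimately show ?thesis
      by (simp add: measure_def)
  qed
  finally show ?thesis
    by simp
qed

text \<open>The final states partition the conditioning event, so its probability is the row total
  of the joint weights.\<close>

lemma measure_at_most_one_jump_total:
  "measure (chain_measure Q) {\<omega> \<in> space (chain_measure Q). num_jumps i 1 \<omega> \<le> 1} =
    (\<Sum>j\<in>UNIV. measure (chain_measure Q)
      {\<omega> \<in> space (chain_measure Q). chain_state i 1 \<omega> = j \<and> num_jumps i 1 \<omega> \<le> 1})"
proof -
  have "C.prob {\<omega> \<in> space (chain_measure Q). num_jumps i 1 \<omega> \<le> 1} =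
      C.prob (\<Union>j\<in>UNIV. {\<omega> \<in> space (chain_measure Q). chain_state i 1 \<omega> = j \<and> num_jumps i 1 \<omega> \<le> 1})"
    by (intro arg_cong [where f = C.prob]) auto
  also have "\<dots> = (\<Sum>j\<in>UNIV. C.prob
      {\<omega> \<in> space (chain_measure Q). chain_state i 1 \<omega> = j \<and> num_jumps i 1 \<omega> \<le> 1})"
    by (intro C.finite_measure_finite_Union) (auto simp: disjoint_family_on_def)
  finally show ?thesis .
qed

end

section \<open>Generators and fixed points\<close>

lemma at_most_one_jump_matrix_eq:
  fixes Q :: "real ^ 'n ^ 'n"
  assumes "intensity_matrix Q"
  defines "w \<equiv> \<lambda>i j. if i = j then exp (Q $ i $ i)
    else Q $ i $ j * exp 1 / rho (exp (1 - Q $ i $ i)) (exp (1 - Q $ j $ j))"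
  shows "at_most_one_jump_matrix Q $ i $ j = w i j / (\<Sum>k\<in>UNIV. w i k)"
  by (simp add: at_most_one_jump_matrix_def cond_prob_def measure_at_most_one_jump_total [OF assms(1)]
      measure_at_most_one_jump [OF assms(1)] w_def)

text \<open>The vector \<open>\<theta>\<close> read off from a matrix by inverting
  \<open>q\<^sub>i\<^sub>i = 1 - ln \<theta>\<^sub>i\<close>.\<close>

definition holding_vector :: "real ^ 'n ^ 'n \<Rightarrow> real ^ 'n" where
  "holding_vector Q = (\<chi> i. exp (1 - Q $ i $ i))"

text \<open>The formula of the theorem with an arbitrary vector \<open>x\<close>, so that the
  condition on \<open>x\<close> for zero row sums can be derived.\<close>

definition fixpoint_generator :: "real ^ 'n ^ 'n \<Rightarrow> real ^ 'n \<Rightarrow> real ^ 'n ^ 'n" where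
  "fixpoint_generator P x =
     (\<chi> i j. if i = j then 1 - ln (x $ i) else rho (x $ i) (x $ j) * P $ i $ j / (x $ i * P $ i $ i))"

lemma positive_holding_vector: "positive_vector (holding_vector Q)"
  by (simp add: positive_vector_def holding_vector_def)

context
  fixes P :: "real ^ 'n ^ 'n"
  assumes P_stochastic: "stochastic_matrix P"
    and P_diag_pos: "\<And>i. 0 < P $ i $ i"
begin

text \<open>The factor \<open>x $ i * P $ i $ i\<close> clears denominators. The 1 in the diagonal
  entry \<open>1 - ln (x $ i)\<close> supplies the summand \<open>j = i\<close>, because
  \<open>rho x x = x\<close>.\<close>

lemma sum_fixpoint_generator:
  assumes "positive_vector x"
  shows "x $ i * P $ i $ i * (\<Sum>j\<in>UNIV. fixpoint_generator P x $ i $ j) =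
    (\<Sum>j\<in>UNIV. P $ i $ j * rho (x $ i) (x $ j)) - P $ i $ i * (x $ i * ln (x $ i))"
proof -
  have pos: "0 < x $ i" "0 < P $ i $ i"
    using assms P_diag_pos by (auto simp: positive_vector_def)
  have "x $ i * P $ i $ i * (\<Sum>j\<in>UNIV. fixpoint_generator P x $ i $ j) =
      (\<Sum>j\<in>UNIV. x $ i * P $ i $ i * fixpoint_generator P x $ i $ j)"
    by (rule sum_distrib_left)
  also have "\<dots> = (\<Sum>j\<in>UNIV. P $ i $ j * rho (x $ i) (x $ j) -
      (if i = j then P $ i $ i * (x $ i * ln (x $ i)) else 0))"
    using pos by (intro sum.cong) (auto simp: fixpoint_generator_def algebra_simps)
  finally show ?thesis
    by (simp add: sum_subtractf)
qed

lemma intensity_fixpoint_generator_iff: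
  assumes "positive_vector x"
  shows "intensity_matrix (fixpoint_generator P x) \<longleftrightarrow> fixpoint_map P x = x"
proof -
  have pos: "0 < x $ i" "0 < P $ i $ i" for i
    using assms P_diag_pos by (auto simp: positive_vector_def)
  have nonneg: "0 \<le> fixpoint_generator P x $ i $ j" if "i \<noteq> j" for i j
    using that pos [of i] pos [of j] P_stochastic rho_pos [of "x $ i" "x $ j"]
    by (simp add: fixpoint_generator_def stochastic_matrix_def)
  have "(\<Sum>j\<in>UNIV. fixpoint_generator P x $ i $ j) = 0 \<longleftrightarrow>
      P $ i $ i * (x $ i * ln (x $ i)) = (\<Sum>j\<in>UNIV. P $ i $ j * rho (x $ i) (x $ j))" for i
  proof -
    have "(\<Sum>j\<in>UNIV. fixpoint_generator P x $ i $ j) = 0 \<longleftrightarrow>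
        x $ i * P $ i $ i * (\<Sum>j\<in>UNIV. fixpoint_generator P x $ i $ j) = 0"
      using pos [of i] by simp
    then show ?thesis
      unfolding sum_fixpoint_generator [OF assms] by auto
  qed
  then show ?thesis
    using nonneg fixpoint_iff [OF P_stochastic P_diag_pos assms] by (simp add: intensity_matrix_def)
qed

text \<open>The joint weights in row \<open>i\<close> are the entries of \<open>P\<close> times a
  common factor \<open>c i\<close>, which conditioning cancels.\<close>

lemma J1_generator_fixpoint_generator:
  assumes x: "positive_vector x" "fixpoint_map P x = x"
  shows "J1_generator P (fixpoint_generator P x)"
proof -
  let ?Q = "fixpoint_generator P x"
  have Q: "intensity_matrix ?Q"
    using x intensity_fixpoint_generator_iff by blast
  have pos: "0 < x $ i" "0 < P $ i $ i" for i
    using x P_diag_pos by (auto simp: positive_vector_def)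
  \<comment> \<open>The no-jump weight \<open>exp 1 / x $ i\<close> divided by
    \<open>P $ i $ i\<close>.\<close>
  define c where "c = (\<lambda>i. exp 1 / (x $ i * P $ i $ i))"
  have diag: "exp (1 - ?Q $ i $ i) = x $ i" for i
    using pos by (simp add: fixpoint_generator_def)
  have w: "(if i = j then exp (?Q $ i $ i)
      else ?Q $ i $ j * exp 1 / rho (exp (1 - ?Q $ i $ i)) (exp (1 - ?Q $ j $ j))) = c i * P $ i $ j" for i j
    unfolding diag using pos [of i] pos [of j] rho_pos [of "x $ i" "x $ j"]
    by (simp add: fixpoint_generator_def c_def exp_diff)
  have "at_most_one_jump_matrix ?Q $ i $ j = P $ i $ j" for i j
    unfolding at_most_one_jump_matrix_eq [OF Q] w sum_distrib_left [symmetric]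
    using pos [of i] P_stochastic by (simp add: stochastic_matrix_def c_def)
  then show ?thesis
    using Q by (simp add: J1_generator_def vec_eq_iff)
qed

text \<open>The normalising constant \<open>Z\<close> of row \<open>i\<close> is eliminated by
  comparing an off-diagonal entry of \<open>P\<close> with the diagonal one, which determines
  \<open>Q $ i $ j\<close>. The zero row sums of \<open>Q\<close> then yield the fixed-point
  equation.\<close>

lemma J1_generator_imp_fixpoint:
  assumes "J1_generator P Q"
  shows "Q = fixpoint_generator P (holding_vector Q)"
    and "fixpoint_map P (holding_vector Q) = holding_vector Q"
proof -
  let ?x = "holding_vector Q"
  have Q: "intensity_matrix Q" and P: "at_most_one_jump_matrix Q = P"
    using assms by (auto simp: J1_generator_def)
  have pos: "0 < ?x $ i" "0 < P $ i $ i" for i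
    using positive_holding_vector [of Q] P_diag_pos by (auto simp: positive_vector_def)
  have x: "exp (1 - Q $ k $ k) = ?x $ k" for k
    by (simp add: holding_vector_def)
  have "Q $ i $ j = fixpoint_generator P ?x $ i $ j" for i j
  proof (cases "i = j")
    case False
    define Z where "Z = (\<Sum>k\<in>UNIV. if i = k then exp (Q $ i $ i)
      else Q $ i $ k * exp 1 / rho (?x $ i) (?x $ k))"
    have Z: "P $ i $ k = (if i = k then exp (Q $ i $ i)
        else Q $ i $ k * exp 1 / rho (?x $ i) (?x $ k)) / Z" for k
      using at_most_one_jump_matrix_eq [OF Q, of i k] by (simp only: P x Z_def)
    \<comment> \<open>Division by zero yields 0, which would contradict the positive diagonal entry
      of \<open>P\<close>.\<close>
    have "Z \<noteq> 0"
      using Z [of i] pos [of i] by (cases "Z = 0") simp_all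
    have r: "0 < rho (?x $ i) (?x $ j)"
      using pos by (intro rho_pos)
    have "?x $ i * exp (Q $ i $ i) = exp 1"
      by (simp add: holding_vector_def mult_exp_exp)
    then have "?x $ i * P $ i $ i = exp 1 / Z" "P $ i $ j = Q $ i $ j * exp 1 / rho (?x $ i) (?x $ j) / Z"
      using Z [of i] Z [of j] False by simp_all
    then show ?thesis
      using \<open>Z \<noteq> 0\<close> r False by (simp add: fixpoint_generator_def)
  qed (simp add: fixpoint_generator_def holding_vector_def)
  then show eq: "Q = fixpoint_generator P ?x"
    by (simp add: vec_eq_iff)
  have "intensity_matrix (fixpoint_generator P ?x)"
    unfolding eq [symmetric] by (rule Q)
  then show "fixpoint_map P ?x = ?x"
    using intensity_fixpoint_generator_iff [OF positive_holding_vector] by blast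
qed

end

theorem theorem2:
  fixes P :: "real ^ 'n ^ 'n"
  assumes "stochastic_matrix P"
    and "\<And>i. 0 < P $ i $ i"
  shows "(\<exists>!Q. J1_generator P Q) \<and>
    (\<exists>!\<theta>. positive_vector \<theta> \<and> fixpoint_map P \<theta> = \<theta>) \<and>
    (\<forall>Q \<theta>. J1_generator P Q \<and> positive_vector \<theta> \<and> fixpoint_map P \<theta> = \<theta> \<longrightarrow>
       (\<forall>i. Q $ i $ i = 1 - ln (\<theta> $ i)) \<and>
       (\<forall>i j. i \<noteq> j \<longrightarrow>
          Q $ i $ j = rho (\<theta> $ i) (\<theta> $ j) * P $ i $ j / (\<theta> $ i * P $ i $ i)))"
proof -
  obtain \<theta> where \<theta>: "positive_vector \<theta>" "fixpoint_map P \<theta> = \<theta>"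
    using fixpoint_exists [OF assms] by blast
  have unique: "x = \<theta>" if "positive_vector x" "fixpoint_map P x = x" for x
    using fixpoint_le [OF assms that \<theta>] fixpoint_le [OF assms \<theta> that]
    by (simp add: vec_eq_iff antisym)
  have gen: "Q = fixpoint_generator P \<theta>" if "J1_generator P Q" for Q
    using J1_generator_imp_fixpoint [OF assms that] unique positive_holding_vector by metis
  have "\<exists>!Q. J1_generator P Q"
    using J1_generator_fixpoint_generator [OF assms \<theta>] gen by blast
  moreover have "\<exists>!\<theta>. positive_vector \<theta> \<and> fixpoint_map P \<theta> = \<theta>"
    using \<theta> unique by blast
  moreover have "(\<forall>i. Q $ i $ i = 1 - ln (\<eta> $ i)) \<and>
      (\<forall>i j. i \<noteq> j \<longrightarrow> Q $ i $ j = rho (\<eta> $ i) (\<eta> $ j) * P $ i $ j / (\<eta> $ i * P $ i $ i))"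
    if "J1_generator P Q \<and> positive_vector \<eta> \<and> fixpoint_map P \<eta> = \<eta>" for Q \<eta>
    using gen [of Q] unique [of \<eta>] that by (simp add: fixpoint_generator_def)
  ultimately show ?thesis
    by blast
qed

end
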